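(* Let $L$ be a $d$-lattice. The following are equivalent: (1) There is a maximal (hence prime) filter of $L$ whose complement $L\setminus F$ (where $F$ denotes that filter) is not a maximal ideal. (2) There is a maximal (hence prime) ideal of $L$ whose complement $L\setminus I$ (where $I$ denotes that ideal) is not a maximal filter. (3) There are two prime ideals in $L$, one properly containing the other. (4) There are two prime filters in $L$, one properly containing the other. (5) There is a lattice homomorphism from $L$ onto the 3-element lattice $\{0,d,1\}$ (the chain $0<d<1$). (6) $L$ is not balanced. (7) $L$ is not complemented. In particular, a $d$-lattice is balanced if and only if it is complemented.
   Context: For elements $x,y$ of a lattice $L$, $\theta(x,y)$ denotes the least (lattice) congruence on $L$ containing the pair $(x,y)$. A $d$-lattice is a bounded lattice $(L,\vee,\wedge,0,1)$ such that for all $a,c\in L$: (i) if $(a,1)\in\theta(0,c)$ then $a\vee c=1$; and (ii) if $(a,0)\in\theta(1,c)$ then $a\wedge c=0$. For a congruence $\phi$ and an element $x$, $x/\phi$ denotes the $\phi$-congruence class of $x$. For a subset $A$, $\theta_A$ denotes the smallest congruence that identifies all elements of $A$. A congruence $\phi$ on an algebra with constants $0$ and $1$ is balanced if $0/\phi=0/\theta_{(1/\phi)}$ and $1/\phi=1/\theta_{(0/\phi)}$. Such an algebra (in particular a bounded lattice) is balanced if all its congruences are balanced; equivalently, for any congruences $\phi,\phi'$ one has $0/\phi=0/\phi'$ if and only if $1/\phi=1/\phi'$. A bounded lattice is complemented if for every $a\in L$ there is $x\in L$ with $a\vee x=1$ and $a\wedge x=0$. Ideals and filters are nonempty. A maximal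 ideal (filter) is a proper ideal (filter) that is maximal under inclusion among proper ideals (filters). A proper ideal $I$ is prime if $x\wedge y\in I$ implies $x\in I$ or $y\in I$; a proper filter $F$ is prime if $x\vee y\in F$ implies $x\in F$ or $y\in F$. *)

theory Defs
  imports Main
begin

text \<open>
  A bounded lattice L is the carrier of a type of class \<^class>\<open>bounded_lattice\<close>; its constants
  0 and 1 are \<^const>\<open>bot\<close> and \<^const>\<open>top\<close>. The one-element lattice is not excluded.
  Congruences are relations, and the class of \<open>x\<close> modulo \<open>\<phi>\<close> is \<open>\<phi> `` {x}\<close>.
\<close>

definition lattice_congruence :: "('a::lattice) rel \<Rightarrow> bool" where
  "lattice_congruence \<phi> \<longleftrightarrow> equiv UNIV \<phi> \<and>
     (\<forall>x x' y y'. (x, x') \<in> \<phi> \<longrightarrow> (y, y') \<in> \<phi> \<longrightarrow>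
        (sup x y, sup x' y') \<in> \<phi> \<and> (inf x y, inf x' y') \<in> \<phi>)"

definition principal_congruence :: "'a::lattice \<Rightarrow> 'a \<Rightarrow> 'a rel" where
  "principal_congruence x y = \<Inter>{\<phi>. lattice_congruence \<phi> \<and> (x, y) \<in> \<phi>}"

definition collapsing_congruence :: "('a::lattice) set \<Rightarrow> 'a rel" where
  "collapsing_congruence A = \<Inter>{\<phi>. lattice_congruence \<phi> \<and> A \<times> A \<subseteq> \<phi>}"

definition d_lattice :: "('a::bounded_lattice) itself \<Rightarrow> bool" where
  "d_lattice _ \<longleftrightarrow> (\<forall>a c :: 'a.
     ((a, top) \<in> principal_congruence bot c \<longrightarrow> sup a c = top) \<and>
     ((a, bot) \<in> principal_congruence top c \<longrightarrow> inf a c = bot))"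

definition balanced_congruence :: "('a::bounded_lattice) rel \<Rightarrow> bool" where
  "balanced_congruence \<phi> \<longleftrightarrow>
     \<phi> `` {bot} = collapsing_congruence (\<phi> `` {top}) `` {bot} \<and>
     \<phi> `` {top} = collapsing_congruence (\<phi> `` {bot}) `` {top}"

definition balanced_lattice :: "('a::bounded_lattice) itself \<Rightarrow> bool" where
  "balanced_lattice _ \<longleftrightarrow> (\<forall>\<phi> :: 'a rel. lattice_congruence \<phi> \<longrightarrow> balanced_congruence \<phi>)"

text \<open>Existence of complements only: no complement operation is chosen, and complements
  need not be unique.\<close>

definition complemented :: "('a::bounded_lattice) itself \<Rightarrow> bool" where
  "complemented _ \<longleftrightarrow> (\<forall>a :: 'a. \<exists>x. sup a x = top \<and> inf a x = bot)"

definition lattice_ideal :: "('a::lattice) set \<Rightarrow> bool" where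
  "lattice_ideal I \<longleftrightarrow> I \<noteq> {} \<and> (\<forall>x y. y \<in> I \<longrightarrow> x \<le> y \<longrightarrow> x \<in> I) \<and>
     (\<forall>x y. x \<in> I \<longrightarrow> y \<in> I \<longrightarrow> sup x y \<in> I)"

definition lattice_filter :: "('a::lattice) set \<Rightarrow> bool" where
  "lattice_filter F \<longleftrightarrow> F \<noteq> {} \<and> (\<forall>x y. x \<in> F \<longrightarrow> x \<le> y \<longrightarrow> y \<in> F) \<and>
     (\<forall>x y. x \<in> F \<longrightarrow> y \<in> F \<longrightarrow> inf x y \<in> F)"

definition proper_ideal :: "('a::lattice) set \<Rightarrow> bool" where
  "proper_ideal I \<longleftrightarrow> lattice_ideal I \<and> I \<noteq> UNIV"

definition proper_filter :: "('a::lattice) set \<Rightarrow> bool" where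
  "proper_filter F \<longleftrightarrow> lattice_filter F \<and> F \<noteq> UNIV"

definition maximal_ideal :: "('a::lattice) set \<Rightarrow> bool" where
  "maximal_ideal I \<longleftrightarrow> proper_ideal I \<and> (\<forall>J. proper_ideal J \<longrightarrow> I \<subseteq> J \<longrightarrow> J = I)"

definition maximal_filter :: "('a::lattice) set \<Rightarrow> bool" where
  "maximal_filter F \<longleftrightarrow> proper_filter F \<and> (\<forall>G. proper_filter G \<longrightarrow> F \<subseteq> G \<longrightarrow> G = F)"

definition prime_ideal :: "('a::lattice) set \<Rightarrow> bool" where
  "prime_ideal I \<longleftrightarrow> proper_ideal I \<and> (\<forall>x y. inf x y \<in> I \<longrightarrow> x \<in> I \<or> y \<in> I)"

definition prime_filter :: "('a::lattice) set \<Rightarrow> bool" where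
  "prime_filter F \<longleftrightarrow> proper_filter F \<and> (\<forall>x y. sup x y \<in> F \<longrightarrow> x \<in> F \<or> y \<in> F)"

definition lattice_hom :: "('a::lattice \<Rightarrow> 'b::lattice) \<Rightarrow> bool" where
  "lattice_hom f \<longleftrightarrow> (\<forall>x y. f (sup x y) = sup (f x) (f y) \<and> f (inf x y) = inf (f x) (f y))"

text \<open>The library's linearly ordered type with three elements serves as the chain 0 < d < 1.\<close>

type_synonym three_chain = Enum.finite_3

end

(*
  The d-property is used only through two one-sided distributive laws: if f meets x and y in 0
  then it meets their join in 0, and dually.  By the first, maximal filters are prime.  By the
  dual one, {x. x \<squnion> a = 1} is a filter; if a has no complement, this filter together with a
  generates a proper filter, and a maximal filter F above it contains a and every x with
  x \<squnion> a = 1, so that the complement of F cannot be a maximal ideal.  Conversely, the complement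
  of F is a prime ideal, so if it is not maximal it lies properly below a maximal, hence prime,
  ideal.  A pair of prime ideals I \<subset> J gives a homomorphism onto the 3-chain; the kernel of such
  a homomorphism and the congruence that moreover identifies d with 1 have the same class of 0
  but different classes of 1.  Complements transport the classes of 0 and 1 into each other, so
  a complemented lattice is balanced.
*)

theory Submission
  imports Defs "HOL-Library.Dual_Ordered_Lattice"
begin

section \<open>Distributivity at 0 and at 1 from the d-property\<close>

definition zero_distributive :: "'a::bounded_lattice itself \<Rightarrow> bool" where
  "zero_distributive _ \<longleftrightarrow>
     (\<forall>f x y :: 'a. inf f x = bot \<longrightarrow> inf f y = bot \<longrightarrow> inf f (sup x y) = bot)"

definition one_distributive :: "'a::bounded_lattice itself \<Rightarrow> bool" where
  "one_distributive _ \<longleftrightarrow>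
     (\<forall>f x y :: 'a. sup f x = top \<longrightarrow> sup f y = top \<longrightarrow> sup f (inf x y) = top)"

lemma lattice_congruence_refl: "lattice_congruence \<phi> \<Longrightarrow> (x, x) \<in> \<phi>"
  by (auto simp: lattice_congruence_def equiv_def refl_on_def)

lemma lattice_congruence_sym: "lattice_congruence \<phi> \<Longrightarrow> (x, y) \<in> \<phi> \<Longrightarrow> (y, x) \<in> \<phi>"
  by (auto simp: lattice_congruence_def equiv_def dest: symD)

lemma lattice_congruence_trans:
  "lattice_congruence \<phi> \<Longrightarrow> (x, y) \<in> \<phi> \<Longrightarrow> (y, z) \<in> \<phi> \<Longrightarrow> (x, z) \<in> \<phi>"
  by (auto simp: lattice_congruence_def equiv_def dest: transD)

lemma lattice_congruence_sup:
  "lattice_congruence \<phi> \<Longrightarrow> (x, x') \<in> \<phi> \<Longrightarrow> (y, y') \<in> \<phi> \<Longrightarrow> (sup x y, sup x' y') \<in> \<phi>"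
  by (simp add: lattice_congruence_def)

lemma lattice_congruence_inf:
  "lattice_congruence \<phi> \<Longrightarrow> (x, x') \<in> \<phi> \<Longrightarrow> (y, y') \<in> \<phi> \<Longrightarrow> (inf x y, inf x' y') \<in> \<phi>"
  by (simp add: lattice_congruence_def)

text \<open>A congruence identifying \<open>top\<close> with \<open>f\<close> identifies each
  \<open>z\<close> with \<open>inf f z\<close>, so every \<open>z\<close> disjoint from
  \<open>f\<close> falls into the class of \<open>bot\<close>, which is closed under joins. The
  second clause of the d-property turns this back into disjointness.\<close>

lemma zero_distributive_if_d_lattice:
  assumes "d_lattice TYPE('a::bounded_lattice)"
  shows "zero_distributive TYPE('a)"
  unfolding zero_distributive_def
proof (intro allI impI)
  fix f x y :: 'a
  assume *: "inf f x = bot" "inf f y = bot"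
  have "(sup x y, bot) \<in> \<phi>" if c: "lattice_congruence \<phi>" and f: "(top, f) \<in> \<phi>" for \<phi>
  proof -
    have "(z, bot) \<in> \<phi>" if "inf f z = bot" for z
      using lattice_congruence_inf[OF c f lattice_congruence_refl[OF c, of z]] that by simp
    from lattice_congruence_sup[OF c this[OF *(1)] this[OF *(2)]] show ?thesis by simp
  qed
  then have "(sup x y, bot) \<in> principal_congruence top f"
    by (simp add: principal_congruence_def)
  with assms show "inf f (sup x y) = bot"
    by (metis d_lattice_def inf_commute)
qed

text \<open>Order-dual argument: modulo a congruence identifying \<open>bot\<close> with
  \<open>f\<close>, every \<open>z\<close> with \<open>sup f z = top\<close> is congruent to
  \<open>top\<close>, and the first clause of the d-property applies.\<close>

lemma one_distributive_if_d_lattice: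
  assumes "d_lattice TYPE('a::bounded_lattice)"
  shows "one_distributive TYPE('a)"
  unfolding one_distributive_def
proof (intro allI impI)
  fix f x y :: 'a
  assume *: "sup f x = top" "sup f y = top"
  have "(inf x y, top) \<in> \<phi>" if c: "lattice_congruence \<phi>" and f: "(bot, f) \<in> \<phi>" for \<phi>
  proof -
    have "(z, top) \<in> \<phi>" if "sup f z = top" for z
      using lattice_congruence_sup[OF c f lattice_congruence_refl[OF c, of z]] that by simp
    from lattice_congruence_inf[OF c this[OF *(1)] this[OF *(2)]] show ?thesis by simp
  qed
  then have "(inf x y, top) \<in> principal_congruence bot f"
    by (simp add: principal_congruence_def)
  with assms show "sup f (inf x y) = top"
    by (metis d_lattice_def sup_commute)
qed

section \<open>Prime ideals and prime filters as complements of each other\<close>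

text \<open>In this form non-membership in \<open>I\<close> is a nonconstant homomorphism to the
  two-element lattice, and passing to the complement merely exchanges conjunction and
  disjunction.\<close>

lemma prime_ideal_iff:
  "prime_ideal I \<longleftrightarrow> I \<noteq> {} \<and> I \<noteq> UNIV \<and>
     (\<forall>x y. sup x y \<in> I \<longleftrightarrow> x \<in> I \<and> y \<in> I) \<and> (\<forall>x y. inf x y \<in> I \<longleftrightarrow> x \<in> I \<or> y \<in> I)"
  (is "_ \<longleftrightarrow> ?R")
proof
  assume I: "prime_ideal I"
  then have sup_closed: "sup x y \<in> I" if "x \<in> I" "y \<in> I" for x y
    using that unfolding prime_ideal_def proper_ideal_def lattice_ideal_def by blast
  have down: "x \<in> I" if "y \<in> I" "x \<le> y" for x y
    using I that unfolding prime_ideal_def proper_ideal_def lattice_ideal_def by blast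
  have "sup x y \<in> I \<longleftrightarrow> x \<in> I \<and> y \<in> I" for x y
    using sup_closed[of x y] down[of "sup x y" x] down[of "sup x y" y] by auto
  moreover have "inf x y \<in> I \<longleftrightarrow> x \<in> I \<or> y \<in> I" for x y
  proof
    show "inf x y \<in> I \<Longrightarrow> x \<in> I \<or> y \<in> I" using I unfolding prime_ideal_def by blast
    show "x \<in> I \<or> y \<in> I \<Longrightarrow> inf x y \<in> I"
      using down[of x "inf x y"] down[of y "inf x y"] by auto
  qed
  ultimately show ?R
    using I unfolding prime_ideal_def proper_ideal_def lattice_ideal_def by simp
next
  assume R: ?R
  have "x \<in> I" if "y \<in> I" "x \<le> y" for x y
  proof -
    have "sup x y = y" using \<open>x \<le> y\<close> by (rule sup_absorb2)
    with R \<open>y \<in> I\<close> show ?thesis by metis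
  qed
  with R show "prime_ideal I"
    unfolding prime_ideal_def proper_ideal_def lattice_ideal_def by simp
qed

lemma prime_filter_iff:
  "prime_filter F \<longleftrightarrow> F \<noteq> {} \<and> F \<noteq> UNIV \<and>
     (\<forall>x y. inf x y \<in> F \<longleftrightarrow> x \<in> F \<and> y \<in> F) \<and> (\<forall>x y. sup x y \<in> F \<longleftrightarrow> x \<in> F \<or> y \<in> F)"
  (is "_ \<longleftrightarrow> ?R")
proof
  assume F: "prime_filter F"
  then have inf_closed: "inf x y \<in> F" if "x \<in> F" "y \<in> F" for x y
    using that unfolding prime_filter_def proper_filter_def lattice_filter_def by blast
  have up: "y \<in> F" if "x \<in> F" "x \<le> y" for x y
    using F that unfolding prime_filter_def proper_filter_def lattice_filter_def by blast
  have "inf x y \<in> F \<longleftrightarrow> x \<in> F \<and> y \<in> F" for x y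
    using inf_closed[of x y] up[of "inf x y" x] up[of "inf x y" y] by auto
  moreover have "sup x y \<in> F \<longleftrightarrow> x \<in> F \<or> y \<in> F" for x y
  proof
    show "sup x y \<in> F \<Longrightarrow> x \<in> F \<or> y \<in> F" using F unfolding prime_filter_def by blast
    show "x \<in> F \<or> y \<in> F \<Longrightarrow> sup x y \<in> F"
      using up[of x "sup x y"] up[of y "sup x y"] by auto
  qed
  ultimately show ?R
    using F unfolding prime_filter_def proper_filter_def lattice_filter_def by simp
next
  assume R: ?R
  have "y \<in> F" if "x \<in> F" "x \<le> y" for x y
  proof -
    have "inf x y = x" using \<open>x \<le> y\<close> by (rule inf_absorb1)
    with R \<open>x \<in> F\<close> show ?thesis by metis
  qed
  with R show "prime_filter F"
    unfolding prime_filter_def proper_filter_def lattice_filter_def by simp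
qed

lemma prime_filter_Compl_iff: "prime_filter (- I) \<longleftrightarrow> prime_ideal I"
  unfolding prime_filter_iff prime_ideal_iff by auto

lemma prime_ideal_Compl_iff: "prime_ideal (- F) \<longleftrightarrow> prime_filter F"
  using prime_filter_Compl_iff[of "- F"] by simp

lemma prime_ideal_pair_iff_prime_filter_pair:
  "(\<exists>I J :: 'a::lattice set. prime_ideal I \<and> prime_ideal J \<and> I \<subset> J) \<longleftrightarrow>
   (\<exists>F G :: 'a set. prime_filter F \<and> prime_filter G \<and> F \<subset> G)"
proof (intro iffI; elim exE conjE)
  fix I J :: "'a set"
  assume "prime_ideal I" "prime_ideal J" "I \<subset> J"
  then have "prime_filter (- J)" "prime_filter (- I)" "- J \<subset> - I"
    by (auto simp: prime_filter_Compl_iff)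
  then show "\<exists>F G :: 'a set. prime_filter F \<and> prime_filter G \<and> F \<subset> G" by metis
next
  fix F G :: "'a set"
  assume "prime_filter F" "prime_filter G" "F \<subset> G"
  then have "prime_ideal (- G)" "prime_ideal (- F)" "- G \<subset> - F"
    by (auto simp: prime_ideal_Compl_iff)
  then show "\<exists>I J :: 'a set. prime_ideal I \<and> prime_ideal J \<and> I \<subset> J" by metis
qed


section \<open>Duality\<close>

text \<open>\<open>dual\<close> is a bijection. As a rewrite rule this removes one
  \<open>dual\<close> from the type of the bound variable, so that statements about
  \<open>'a dual\<close> become statements about \<open>'a\<close>.\<close>

lemma All_dual: "(\<forall>x. P x) \<longleftrightarrow> (\<forall>x. P (dual x))"
  by (metis dual_undual)

lemma Ex_dual: "(\<exists>x. P x) \<longleftrightarrow> (\<exists>x. P (dual x))"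
  by (metis dual_undual)

text \<open>The first four laws, used from right to left, gather an expression over
  \<open>'a dual\<close> under one outer \<open>dual\<close>; the last two then remove it from
  equations and inequalities.\<close>

lemmas dual_ops = dual_sup_eq[symmetric] dual_inf_eq[symmetric] dual_top_eq[symmetric]
  dual_bot_eq[symmetric] eq_dual_iff less_eq_dual_iff

lemma zero_distributive_dual_iff:
  "zero_distributive TYPE('a dual) \<longleftrightarrow> one_distributive TYPE('a::bounded_lattice)"
  by (simp only: zero_distributive_def one_distributive_def All_dual dual_ops)

lemma one_distributive_dual_iff:
  "one_distributive TYPE('a dual) \<longleftrightarrow> zero_distributive TYPE('a::bounded_lattice)"
  by (simp only: zero_distributive_def one_distributive_def All_dual dual_ops)

lemma complemented_dual_iff:
  "complemented TYPE('a dual) \<longleftrightarrow> complemented TYPE('a::bounded_lattice)"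
  by (simp only: complemented_def All_dual Ex_dual dual_ops conj_commute)

text \<open>Every set over \<open>'a dual\<close> is a preimage under \<open>undual\<close>, so
  quantifiers over sets, as in maximality, can be transferred as well.\<close>

lemma All_vimage_undual: "(\<forall>A. P A) \<longleftrightarrow> (\<forall>A. P (undual -` A))"
proof -
  have "B = undual -` (dual -` B)" for B by auto
  then show ?thesis by metis
qed

lemma vimage_undual_subset_iff: "undual -` A \<subseteq> undual -` B \<longleftrightarrow> A \<subseteq> B"
  using surj_undual by (metis surj_image_vimage_eq image_mono vimage_mono)

lemma vimage_undual_eq_iff: "undual -` A = undual -` B \<longleftrightarrow> A = B"
  by (simp add: vimage_undual_subset_iff set_eq_subset)

lemma vimage_undual_eq_empty_iff: "undual -` A = {} \<longleftrightarrow> A = {}"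
  using vimage_undual_eq_iff[of A "{}"] by simp

lemma vimage_undual_eq_UNIV_iff: "undual -` A = UNIV \<longleftrightarrow> A = UNIV"
  using vimage_undual_eq_iff[of A UNIV] by simp

text \<open>Order reversal turns upward closure into downward closure with the two variables
  exchanged, hence the final use of \<open>all_comm\<close>.\<close>

lemma proper_filter_dual_iff: "proper_filter (undual -` I) \<longleftrightarrow> proper_ideal I"
  unfolding proper_filter_def lattice_filter_def proper_ideal_def lattice_ideal_def
  by (simp only: vimage_undual_eq_empty_iff vimage_undual_eq_UNIV_iff vimage_eq All_dual
      dual_ops undual_dual)
    (intro conj_cong refl all_comm)

lemma proper_ideal_dual_iff: "proper_ideal (undual -` F) \<longleftrightarrow> proper_filter F"
  unfolding proper_filter_def lattice_filter_def proper_ideal_def lattice_ideal_def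
  by (simp only: vimage_undual_eq_empty_iff vimage_undual_eq_UNIV_iff vimage_eq All_dual
      dual_ops undual_dual)
    (intro conj_cong refl all_comm)

lemma maximal_filter_dual_iff: "maximal_filter (undual -` I) \<longleftrightarrow> maximal_ideal I"
  unfolding maximal_filter_def maximal_ideal_def
  by (subst All_vimage_undual)
    (simp only: proper_filter_dual_iff vimage_undual_subset_iff vimage_undual_eq_iff)

lemma maximal_ideal_dual_iff: "maximal_ideal (undual -` F) \<longleftrightarrow> maximal_filter F"
  unfolding maximal_filter_def maximal_ideal_def
  by (subst All_vimage_undual)
    (simp only: proper_ideal_dual_iff vimage_undual_subset_iff vimage_undual_eq_iff)

lemma prime_filter_dual_iff: "prime_filter (undual -` I) \<longleftrightarrow> prime_ideal I"
  unfolding prime_filter_def prime_ideal_def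
  by (simp only: proper_filter_dual_iff vimage_eq All_dual dual_ops undual_dual)


section \<open>Maximal filters and ideals\<close>

lemma proper_filter_iff_bot_notin:
  fixes F :: "'a::bounded_lattice set"
  shows "proper_filter F \<longleftrightarrow> lattice_filter F \<and> bot \<notin> F"
  unfolding proper_filter_def lattice_filter_def using bot_least by blast

text \<open>This set is the filter generated by \<open>F\<close> and \<open>a\<close>; the meet of
  two witnesses from \<open>F\<close> is a witness for the meet.\<close>

lemma lattice_filter_adjoin:
  assumes "lattice_filter F"
  shows "lattice_filter {z. \<exists>f\<in>F. inf f a \<le> z}"
  unfolding lattice_filter_def
proof (intro conjI allI impI)
  show "{z. \<exists>f\<in>F. inf f a \<le> z} \<noteq> {}"
    using assms unfolding lattice_filter_def by blast
next
  fix x y assume "x \<in> {z. \<exists>f\<in>F. inf f a \<le> z}" "x \<le> y"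
  then show "y \<in> {z. \<exists>f\<in>F. inf f a \<le> z}" by (auto intro: order_trans)
next
  fix x y assume "x \<in> {z. \<exists>f\<in>F. inf f a \<le> z}" "y \<in> {z. \<exists>f\<in>F. inf f a \<le> z}"
  then obtain f g where fg: "f \<in> F" "g \<in> F" "inf f a \<le> x" "inf g a \<le> y" by auto
  have "inf (inf f g) a \<le> inf f a" "inf (inf f g) a \<le> inf g a"
    by (simp_all add: le_infI1)
  with fg have "inf (inf f g) a \<le> inf x y" by (meson le_inf_iff order_trans)
  moreover have "inf f g \<in> F" using assms fg unfolding lattice_filter_def by blast
  ultimately show "inf x y \<in> {z. \<exists>f\<in>F. inf f a \<le> z}" by blast
qed

text \<open>By maximality the filter generated by \<open>F\<close> and \<open>x\<close> is improper,
  so it contains \<open>bot\<close>; a witness of this is the required \<open>f\<close>.\<close>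

lemma maximal_filter_disjoint:
  fixes F :: "'a::bounded_lattice set"
  assumes F: "maximal_filter F" and x: "x \<notin> F"
  obtains f where "f \<in> F" "inf f x = bot"
proof -
  let ?G = "{z. \<exists>f\<in>F. inf f x \<le> z}"
  have filter: "lattice_filter F" and ne: "F \<noteq> {}"
    using F by (auto simp: maximal_filter_def proper_filter_def lattice_filter_def)
  have "F \<subseteq> ?G" "x \<in> ?G"
    using ne by (auto intro: inf_le1 inf_le2)
  with F x have "\<not> proper_filter ?G"
    unfolding maximal_filter_def by blast
  with lattice_filter_adjoin[OF filter] have "bot \<in> ?G"
    by (simp add: proper_filter_iff_bot_notin)
  then show ?thesis using that by (auto simp: bot_unique)
qed

text \<open>If \<open>x\<close> and \<open>y\<close> lie outside \<open>F\<close>, some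
  \<open>f\<close> and \<open>g\<close> in \<open>F\<close> are disjoint from them. Then
  \<open>inf f g\<close> is disjoint from both, hence from \<open>sup x y\<close>, and
  \<open>F\<close> would contain \<open>bot\<close>.\<close>

lemma maximal_filter_imp_prime_filter:
  fixes F :: "'a::bounded_lattice set"
  assumes zd: "zero_distributive TYPE('a)" and F: "maximal_filter F"
  shows "prime_filter F"
  unfolding prime_filter_def
proof (intro conjI allI impI)
  show "proper_filter F" using F by (simp add: maximal_filter_def)
  then have filter: "lattice_filter F" and bot: "bot \<notin> F"
    by (simp_all add: proper_filter_iff_bot_notin)
  have inf_closed: "inf x y \<in> F" if "x \<in> F" "y \<in> F" for x y
    using filter that unfolding lattice_filter_def by blast
  fix x y assume xy: "sup x y \<in> F"
  show "x \<in> F \<or> y \<in> F"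
  proof (rule ccontr)
    assume "\<not> (x \<in> F \<or> y \<in> F)"
    then obtain f g where fg: "f \<in> F" "inf f x = bot" "g \<in> F" "inf g y = bot"
      using maximal_filter_disjoint[OF F] by metis
    have "inf (inf f g) x \<le> inf f x" "inf (inf f g) y \<le> inf g y"
      by (simp_all add: le_infI1)
    with fg have "inf (inf f g) x = bot" "inf (inf f g) y = bot"
      by (simp_all add: bot_unique)
    with zd have "inf (inf f g) (sup x y) = bot"
      unfolding zero_distributive_def by blast
    with inf_closed[OF inf_closed[OF fg(1,3)] xy] bot show False by simp
  qed
qed

text \<open>Zorn's lemma: the union of a nonempty chain of proper filters is a filter and still
  omits \<open>bot\<close>.\<close>

lemma maximal_filter_exists:
  fixes F :: "'a::bounded_lattice set"
  assumes F: "proper_filter F"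
  obtains M where "maximal_filter M" "F \<subseteq> M"
proof -
  let ?A = "{G. proper_filter G \<and> F \<subseteq> G}"
  have "\<Union>C \<in> ?A" if ne: "C \<noteq> {}" and chain: "subset.chain ?A C" for C
  proof -
    have C: "lattice_filter G" "bot \<notin> G" "F \<subseteq> G" if "G \<in> C" for G
      using chain that by (auto simp: subset_chain_def proper_filter_iff_bot_notin)
    have "lattice_filter (\<Union>C)"
      unfolding lattice_filter_def
    proof (intro conjI allI impI)
      show "\<Union>C \<noteq> {}" using ne C(1) by (fastforce simp: lattice_filter_def)
    next
      fix x y assume "x \<in> \<Union>C" "x \<le> y"
      then show "y \<in> \<Union>C" using C(1) unfolding lattice_filter_def by blast
    next
      fix x y assume "x \<in> \<Union>C" "y \<in> \<Union>C"
      then obtain G H where "G \<in> C" "x \<in> G" "H \<in> C" "y \<in> H" by blast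
      moreover from this have "G \<subseteq> H \<or> H \<subseteq> G"
        using chain by (simp add: subset_chain_def)
      \<comment> \<open>The larger of the two chain members contains both elements.\<close>
      ultimately obtain G where "G \<in> C" "x \<in> G" "y \<in> G" by blast
      then show "inf x y \<in> \<Union>C" using C(1) unfolding lattice_filter_def by blast
    qed
    moreover have "bot \<notin> \<Union>C" using C(2) by blast
    moreover have "F \<subseteq> \<Union>C" using ne C(3) by blast
    ultimately show ?thesis by (simp add: proper_filter_iff_bot_notin)
  qed
  with F obtain M where M: "M \<in> ?A" "\<forall>X\<in>?A. M \<subseteq> X \<longrightarrow> X = M"
    using subset_Zorn_nonempty[of ?A] by blast
  then have "maximal_filter M"
    unfolding maximal_filter_def by blast
  with M that show ?thesis by blast
qed

lemma not_complemented_imp_maximal_filter: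
  assumes od: "one_distributive TYPE('a::bounded_lattice)"
    and nc: "\<not> complemented TYPE('a)"
  shows "\<exists>F :: 'a set. maximal_filter F \<and> \<not> maximal_ideal (- F)"
proof -
  obtain a :: 'a where a: "\<And>x. sup a x = top \<Longrightarrow> inf a x \<noteq> bot"
    using nc unfolding complemented_def by blast
  let ?D = "{x. sup a x = top}"
  have D: "lattice_filter ?D"
    unfolding lattice_filter_def
  proof (intro conjI allI impI)
    show "?D \<noteq> {}" using sup_top_right by blast
  next
    fix x y assume "x \<in> ?D" "x \<le> y"
    then have "top \<le> sup a y" using sup_mono[of a a x y] by simp
    then show "y \<in> ?D" by (simp add: top_unique)
  next
    fix x y assume "x \<in> ?D" "y \<in> ?D"
    then show "inf x y \<in> ?D" using od by (simp add: one_distributive_def)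
  qed
  let ?G = "{z. \<exists>x\<in>?D. inf x a \<le> z}"
  \<comment> \<open>Otherwise some \<open>x\<close> in \<open>?D\<close> would satisfy
    \<open>inf x a = bot\<close> and be a complement of \<open>a\<close>.\<close>
  have "bot \<notin> ?G" using a by (auto simp: bot_unique inf_commute)
  with lattice_filter_adjoin[OF D] have "proper_filter ?G"
    by (simp add: proper_filter_iff_bot_notin)
  then obtain F where F: "maximal_filter F" "?G \<subseteq> F" by (rule maximal_filter_exists)
  have "a \<in> ?G" using sup_top_right[of a] by (auto intro!: exI[of _ top])
  with F(2) have "a \<in> F" ..
  have D_F: "x \<in> F" if "sup a x = top" for x
    using F(2) that by (auto intro: inf_le1)
  have "\<not> maximal_ideal (- F)"
  proof
    \<comment> \<open>As \<open>a\<close> lies outside the ideal \<open>- F\<close>, the dual of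
      \<open>maximal_filter_disjoint\<close> gives an element outside \<open>F\<close> whose join
      with \<open>a\<close> is \<open>top\<close>. But \<open>F\<close> contains all elements with
      such a join.\<close>
    assume "maximal_ideal (- F)"
    then have "maximal_filter (undual -` (- F))"
      by (simp only: maximal_filter_dual_iff)
    then obtain f where "f \<in> undual -` (- F)" "inf f (dual a) = bot"
      using maximal_filter_disjoint[of "undual -` (- F)" "dual a"] \<open>a \<in> F\<close> by auto
    then have "undual f \<notin> F" "sup a (undual f) = top"
      by (auto simp: dual_eq_iff sup_commute)
    with D_F show False by blast
  qed
  with F show ?thesis by blast
qed

section \<open>Ideal versions through the dual lattice\<close>

lemma maximal_ideal_imp_prime_ideal:
  fixes I :: "'a::bounded_lattice set"
  assumes "one_distributive TYPE('a)" and "maximal_ideal I"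
  shows "prime_ideal I"
  using maximal_filter_imp_prime_filter[of "undual -` I"] assms
  by (simp add: zero_distributive_dual_iff maximal_filter_dual_iff prime_filter_dual_iff)

lemma maximal_ideal_exists:
  fixes I :: "'a::bounded_lattice set"
  assumes "proper_ideal I"
  obtains M where "maximal_ideal M" "I \<subseteq> M"
proof -
  have "proper_filter (undual -` I)"
    using assms by (simp add: proper_filter_dual_iff)
  then obtain N where N: "maximal_filter N" "undual -` I \<subseteq> N"
    by (rule maximal_filter_exists)
  have "N = undual -` (dual -` N)" by auto
  with N that[of "dual -` N"] show ?thesis
    by (metis maximal_filter_dual_iff vimage_undual_subset_iff)
qed

lemma not_complemented_imp_maximal_ideal:
  assumes "zero_distributive TYPE('a::bounded_lattice)" and "\<not> complemented TYPE('a)"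
  shows "\<exists>I :: 'a set. maximal_ideal I \<and> \<not> maximal_filter (- I)"
proof -
  obtain F :: "'a dual set" where F: "maximal_filter F" "\<not> maximal_ideal (- F)"
    using not_complemented_imp_maximal_filter[where 'a = "'a dual"] assms
    by (auto simp: one_distributive_dual_iff complemented_dual_iff)
  \<comment> \<open>The preimage of \<open>F\<close> under \<open>dual\<close> is the required
    ideal; this form of \<open>F\<close> lets the duality lemmas apply.\<close>
  have "F = undual -` (dual -` F)" by auto
  with F show ?thesis
    by (metis maximal_filter_dual_iff maximal_ideal_dual_iff vimage_Compl)
qed

section \<open>Nested prime ideals from maximal filters and ideals\<close>

lemma maximal_filter_imp_prime_ideal_pair:
  fixes F :: "'a::bounded_lattice set"
  assumes zd: "zero_distributive TYPE('a)" and od: "one_distributive TYPE('a)"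
    and F: "maximal_filter F" "\<not> maximal_ideal (- F)"
  shows "\<exists>I J :: 'a set. prime_ideal I \<and> prime_ideal J \<and> I \<subset> J"
proof -
  have I: "prime_ideal (- F)"
    using maximal_filter_imp_prime_filter[OF zd F(1)] by (simp add: prime_ideal_Compl_iff)
  then obtain J where J: "maximal_ideal J" "- F \<subseteq> J"
    using maximal_ideal_exists by (metis prime_ideal_def)
  with F(2) have "- F \<subset> J" by blast
  with I maximal_ideal_imp_prime_ideal[OF od J(1)] show ?thesis by blast
qed

text \<open>The prime filter \<open>- I\<close> lies properly below a maximal, hence prime, filter;
  complements turn this pair of filters into a pair of ideals.\<close>

lemma maximal_ideal_imp_prime_ideal_pair:
  fixes I :: "'a::bounded_lattice set"
  assumes zd: "zero_distributive TYPE('a)" and od: "one_distributive TYPE('a)"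
    and I: "maximal_ideal I" "\<not> maximal_filter (- I)"
  shows "\<exists>I J :: 'a set. prime_ideal I \<and> prime_ideal J \<and> I \<subset> J"
proof -
  have F: "prime_filter (- I)"
    using maximal_ideal_imp_prime_ideal[OF od I(1)] by (simp add: prime_filter_Compl_iff)
  then obtain G where G: "maximal_filter G" "- I \<subseteq> G"
    using maximal_filter_exists by (metis prime_filter_def)
  with I(2) have "- I \<subset> G" by blast
  with F maximal_filter_imp_prime_filter[OF zd G(1)] show ?thesis
    unfolding prime_ideal_pair_iff_prime_filter_pair by blast
qed


section \<open>The three-element chain and balancedness\<close>

abbreviation three_mid :: three_chain where
  "three_mid \<equiv> Enum.finite_3.a\<^sub>2"

text \<open>A map to the chain is determined by the preimages of {0} and {0, d}; it preserves joins
  and meets when these are prime ideals, here \<open>I\<close> and \<open>J\<close>. The inclusion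
  being strict, d is attained.\<close>

lemma prime_ideal_pair_imp_hom_onto_three_chain:
  fixes I J :: "'a::lattice set"
  assumes I: "prime_ideal I" and J: "prime_ideal J" and IJ: "I \<subset> J"
  shows "\<exists>f :: 'a \<Rightarrow> three_chain. lattice_hom f \<and> surj f"
proof -
  define f :: "'a \<Rightarrow> three_chain" where
    "f x = (if x \<in> I then bot else if x \<in> J then three_mid else top)" for x
  have "lattice_hom f"
    using I J IJ unfolding lattice_hom_def prime_ideal_iff f_def
    by (auto simp: max_def min_def less_eq_finite_3_def less_finite_3_def)
  moreover have "surj f"
  proof -
    have "I \<noteq> {}" "J \<noteq> UNIV" using I J unfolding prime_ideal_iff by simp_all
    with IJ obtain x y z where "x \<in> I" "y \<in> J - I" "z \<notin> J" by blast
    then have "f x = bot" "f y = three_mid" "f z = top" using IJ by (auto simp: f_def)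
    then show ?thesis
      by (metis (full_types) surj_def finite_3.exhaust bot_finite_3_def top_finite_3_def)
  qed
  ultimately show ?thesis by blast
qed

text \<open>In the chain {0} is a prime ideal, and surjectivity makes its preimage nonempty and
  proper.\<close>

lemma prime_ideal_vimage_bot_three_chain:
  fixes f :: "'a::lattice \<Rightarrow> three_chain"
  assumes hom: "lattice_hom f" and surj: "surj f"
  shows "prime_ideal {x. f x = bot}"
proof -
  obtain x y where xy: "f x = bot" "f y = top"
    using surj by (metis surjD)
  have ops: "sup u v = bot \<longleftrightarrow> u = bot \<and> v = bot" "inf u v = bot \<longleftrightarrow> u = bot \<or> v = bot"
    for u v :: three_chain
    by (cases u; cases v; simp add: max_def min_def less_eq_finite_3_def less_finite_3_def)+
  have "bot \<noteq> (top :: three_chain)" by simp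
  with hom xy show ?thesis
    unfolding prime_ideal_iff
    by (auto simp only: lattice_hom_def ops mem_Collect_eq set_eq_iff empty_iff UNIV_I) metis
qed

text \<open>This is the kernel of the homomorphism to the two-element lattice given by
  \<open>I\<close>.\<close>

lemma lattice_congruence_prime_ideal:
  "prime_ideal I \<Longrightarrow> lattice_congruence {(x, y). x \<in> I \<longleftrightarrow> y \<in> I}"
  unfolding lattice_congruence_def prime_ideal_iff
  by (auto simp: equiv_def refl_on_def sym_def trans_def)

lemma lattice_congruence_kernel:
  "lattice_hom f \<Longrightarrow> lattice_congruence {(x, y). f x = f y}"
  unfolding lattice_congruence_def lattice_hom_def
  by (auto simp: equiv_def refl_on_def sym_def trans_def)

lemma hom_onto_three_chain_imp_not_balanced:
  fixes f :: "'a::bounded_lattice \<Rightarrow> three_chain"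
  assumes hom: "lattice_hom f" and surj: "surj f"
  shows "\<not> balanced_lattice TYPE('a)"
proof
  assume bal: "balanced_lattice TYPE('a)"
  let ?\<phi> = "{(x, y). f x = f y}" and ?\<psi> = "{(x, y). f x = bot \<longleftrightarrow> f y = bot}"
  obtain x y z where xyz: "f x = bot" "f y = three_mid" "f z = top"
    using surj by (metis surjD)
  \<comment> \<open>\<open>lattice_hom\<close> speaks only of joins and meets; the bounds are
    preserved because \<open>f\<close> attains 0 and 1.\<close>
  have fbot: "f bot = bot" and ftop: "f top = top"
    using hom xyz unfolding lattice_hom_def
    by (metis inf_bot_left inf_bot_right, metis sup_top_left sup_top_right)
  have "lattice_congruence ?\<psi>"
    using lattice_congruence_prime_ideal[OF prime_ideal_vimage_bot_three_chain[OF assms]]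
    by simp
  with bal have "?\<psi> `` {top} = collapsing_congruence (?\<psi> `` {bot}) `` {top}"
    unfolding balanced_lattice_def balanced_congruence_def by blast
  \<comment> \<open>Both classes consist of the elements sent to 0. Balancedness recovers the class
    of \<open>top\<close> from the class of \<open>bot\<close>, so the classes of \<open>top\<close>
    would agree too.\<close>
  also have "?\<psi> `` {bot} = ?\<phi> `` {bot}" using fbot by auto
  also have "collapsing_congruence (?\<phi> `` {bot}) `` {top} = ?\<phi> `` {top}"
    using bal lattice_congruence_kernel[OF hom]
    unfolding balanced_lattice_def balanced_congruence_def by blast
  finally have "?\<psi> `` {top} = ?\<phi> `` {top}" .
  \<comment> \<open>The element \<open>y\<close> over d separates the two classes of
    \<open>top\<close>.\<close>
  moreover have "y \<in> ?\<psi> `` {top}" "y \<notin> ?\<phi> `` {top}"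
    using xyz ftop by simp_all
  ultimately show False by blast
qed

text \<open>The congruence generated by a class of \<phi> lies inside \<phi>, which gives one
  inclusion. For the other, a complement moves an element of one class into the other class, where
  the generated congruence can act.\<close>

lemma complemented_imp_balanced:
  assumes comp: "complemented TYPE('a::bounded_lattice)"
  shows "balanced_lattice TYPE('a)"
  unfolding balanced_lattice_def balanced_congruence_def
proof (intro allI impI conjI equalityI subsetI)
  fix \<phi> :: "'a rel" and x
  assume c: "lattice_congruence \<phi>"
  note refl = lattice_congruence_refl and sym = lattice_congruence_sym
    and trans = lattice_congruence_trans
  have le: "collapsing_congruence (\<phi> `` {t}) \<subseteq> \<phi>" for t
    unfolding collapsing_congruence_def using c sym[OF c] trans[OF c] by blast
  show "x \<in> \<phi> `` {bot}" if "x \<in> collapsing_congruence (\<phi> `` {top}) `` {bot}"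
    using le that by blast
  show "x \<in> \<phi> `` {top}" if "x \<in> collapsing_congruence (\<phi> `` {bot}) `` {top}"
    using le that by blast
  obtain x' where x': "sup x x' = top" "inf x x' = bot"
    using comp unfolding complemented_def by blast
  show "x \<in> collapsing_congruence (\<phi> `` {top}) `` {bot}" if "x \<in> \<phi> `` {bot}"
  proof -
    \<comment> \<open>Join \<open>bot\<close> and \<open>x\<close>, congruent modulo \<phi>, with
      \<open>x'\<close>.\<close>
    have "(top, x') \<in> \<phi>"
      using lattice_congruence_sup[OF c _ refl[OF c], of bot x x'] that x' sym[OF c] by simp
    \<comment> \<open>Now \<open>x'\<close> and \<open>top\<close> are congruent modulo \<psi>;
      their meets with \<open>x\<close> are \<open>bot\<close> and \<open>x\<close>.\<close>
    then have "(bot, x) \<in> \<psi>"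
      if "lattice_congruence \<psi>" "\<phi> `` {top} \<times> \<phi> `` {top} \<subseteq> \<psi>" for \<psi>
      using lattice_congruence_inf[OF that(1) refl[OF that(1)], of x' top x] that(2) x' refl[OF c]
      by auto
    then show ?thesis by (auto simp: collapsing_congruence_def)
  qed
  show "x \<in> collapsing_congruence (\<phi> `` {bot}) `` {top}" if "x \<in> \<phi> `` {top}"
  proof -
    have "(bot, x') \<in> \<phi>"
      using lattice_congruence_inf[OF c _ refl[OF c], of top x x'] that x' sym[OF c] by simp
    then have "(top, x) \<in> \<psi>"
      if "lattice_congruence \<psi>" "\<phi> `` {bot} \<times> \<phi> `` {bot} \<subseteq> \<psi>" for \<psi>
      using lattice_congruence_sup[OF that(1) refl[OF that(1)], of x' bot x] that(2) x' refl[OF c]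
      by auto
    then show ?thesis by (auto simp: collapsing_congruence_def)
  qed
qed

section \<open>The equivalences\<close>

theorem theorem5:
  assumes "d_lattice TYPE('a::bounded_lattice)"
  shows
    "(\<forall>F :: 'a set. maximal_filter F \<longrightarrow> prime_filter F) \<and>
     (\<forall>I :: 'a set. maximal_ideal I \<longrightarrow> prime_ideal I) \<and>
     ((\<exists>F :: 'a set. maximal_filter F \<and> \<not> maximal_ideal (- F))
        \<longleftrightarrow> (\<exists>I :: 'a set. maximal_ideal I \<and> \<not> maximal_filter (- I))) \<and>
     ((\<exists>I :: 'a set. maximal_ideal I \<and> \<not> maximal_filter (- I))
        \<longleftrightarrow> (\<exists>I J :: 'a set. prime_ideal I \<and> prime_ideal J \<and> I \<subset> J)) \<and>
     ((\<exists>I J :: 'a set. prime_ideal I \<and> prime_ideal J \<and> I \<subset> J)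
        \<longleftrightarrow> (\<exists>F G :: 'a set. prime_filter F \<and> prime_filter G \<and> F \<subset> G)) \<and>
     ((\<exists>F G :: 'a set. prime_filter F \<and> prime_filter G \<and> F \<subset> G)
        \<longleftrightarrow> (\<exists>f :: 'a \<Rightarrow> three_chain. lattice_hom f \<and> surj f)) \<and>
     ((\<exists>f :: 'a \<Rightarrow> three_chain. lattice_hom f \<and> surj f)
        \<longleftrightarrow> \<not> balanced_lattice TYPE('a)) \<and>
     (\<not> balanced_lattice TYPE('a) \<longleftrightarrow> \<not> complemented TYPE('a)) \<and>
     (balanced_lattice TYPE('a) \<longleftrightarrow> complemented TYPE('a))"
proof -
  note zd = zero_distributive_if_d_lattice[OF assms]
    and od = one_distributive_if_d_lattice[OF assms]
  let ?P1 = "\<exists>F :: 'a set. maximal_filter F \<and> \<not> maximal_ideal (- F)"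
  let ?P2 = "\<exists>I :: 'a set. maximal_ideal I \<and> \<not> maximal_filter (- I)"
  let ?P3 = "\<exists>I J :: 'a set. prime_ideal I \<and> prime_ideal J \<and> I \<subset> J"
  let ?P4 = "\<exists>F G :: 'a set. prime_filter F \<and> prime_filter G \<and> F \<subset> G"
  let ?P5 = "\<exists>f :: 'a \<Rightarrow> three_chain. lattice_hom f \<and> surj f"
  \<comment> \<open>The implications run in a cycle from \<open>?P1\<close> through
    \<open>?P3\<close>, \<open>?P5\<close>, failure of balancedness and failure of complementedness
    back to \<open>?P1\<close>. A side path from the last of these to \<open>?P3\<close> passes
    through \<open>?P2\<close>, and \<open>?P4\<close> is tied to \<open>?P3\<close> by
    complementation.\<close>
  have "?P1 \<Longrightarrow> ?P3" using maximal_filter_imp_prime_ideal_pair[OF zd od] by blast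
  moreover have "?P2 \<Longrightarrow> ?P3" using maximal_ideal_imp_prime_ideal_pair[OF zd od] by blast
  moreover have "?P3 \<longleftrightarrow> ?P4" by (rule prime_ideal_pair_iff_prime_filter_pair)
  moreover have "?P3 \<Longrightarrow> ?P5" using prime_ideal_pair_imp_hom_onto_three_chain by blast
  moreover have "?P5 \<Longrightarrow> \<not> balanced_lattice TYPE('a)"
    using hom_onto_three_chain_imp_not_balanced by blast
  moreover have "\<not> balanced_lattice TYPE('a) \<Longrightarrow> \<not> complemented TYPE('a)"
    using complemented_imp_balanced by blast
  moreover have "\<not> complemented TYPE('a) \<Longrightarrow> ?P1"
    by (rule not_complemented_imp_maximal_filter[OF od])
  moreover have "\<not> complemented TYPE('a) \<Longrightarrow> ?P2"
    by (rule not_complemented_imp_maximal_ideal[OF zd])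
  ultimately have "?P1 \<longleftrightarrow> ?P2" "?P2 \<longleftrightarrow> ?P3" "?P3 \<longleftrightarrow> ?P4" "?P4 \<longleftrightarrow> ?P5"
    "?P5 \<longleftrightarrow> \<not> balanced_lattice TYPE('a)"
    "\<not> balanced_lattice TYPE('a) \<longleftrightarrow> \<not> complemented TYPE('a)"
    by argo+
  moreover have "\<forall>F :: 'a set. maximal_filter F \<longrightarrow> prime_filter F"
    using maximal_filter_imp_prime_filter[OF zd] by blast
  moreover have "\<forall>I :: 'a set. maximal_ideal I \<longrightarrow> prime_ideal I"
    using maximal_ideal_imp_prime_ideal[OF od] by blast
  ultimately show ?thesis by argo
qed

end
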